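(* For every integer $d$ with $2\leq d<\infty$, the graph property "$G$ is of diameter at most $d$" (that is, any two vertices are joined by a path of length at most $d$ in $G$), for graphs $G$ on the vertex set $\mathbb{N}$, is $\infty$-elusive.
   Context: Let $[\mathbb{N}]^2=\{\{n,k\}: n,k\in\mathbb{N},\ n\neq k\}$. A graph on $\mathbb{N}$ is a subset $G\subseteq[\mathbb{N}]^2$, so the set of graphs is $2^{[\mathbb{N}]^2}$. A graph property is an isomorphism-invariant subset $\mathcal{S}\subseteq 2^{[\mathbb{N}]^2}$. The game $G(\mathcal{S})$. Two players, Seeker and Hider, colour the edges of the complete graph on $\mathbb{N}$ with red, white, green. Initially all edges are white. In each turn Seeker picks a white edge and Hider recolours it green or red. The game terminates after infinitely many (that is, $\omega$ many) turns. Let $R_\infty,W_\infty,G_\infty$ be the sets of red, white and green edges at the end, and let $\mathcal{P}_\infty=\{G\subseteq[\mathbb{N}]^2: G_\infty\subseteq G\subseteq G_\infty\cup W_\infty\}$. Seeker wins if and only if $W_\infty\neq\emptyset$ and either $\mathcal{P}_\infty\subseteq\mathcal{S}$ or $\mathcal{P}_\infty\subseteq 2^{[\mathbb{N}]^2}\setminus\mathcal{S}$; otherwise Hider wins. The property $\mathcal{S}$ is $\infty$-elusive if Seeker does not have a winning strategy in $G(\mathcal{S})$. *)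

theory Defs imports Main begin

section \<open>Graphs on the natural numbers\<close>

type_synonym edge = "nat set"
type_synonym graph = "edge set"

definition all_edges :: "edge set" where
  "all_edges = {{n, k} | n k. n \<noteq> k}"

definition all_graphs :: "graph set" where
  "all_graphs = Pow all_edges"

definition graph_property :: "graph set \<Rightarrow> bool" where
  "graph_property S \<longleftrightarrow> S \<subseteq> all_graphs \<and>
     (\<forall>G \<in> all_graphs. \<forall>\<pi>. bij \<pi> \<longrightarrow> ((\<lambda>e. \<pi> ` e) ` G \<in> S \<longleftrightarrow> G \<in> S))"

text \<open>Paths are given by their list of vertices, without repetition; the length of a path is its
  number of edges, and a single vertex is a path of length \<open>0\<close> from itself to itself.\<close>

definition is_path :: "graph \<Rightarrow> nat \<Rightarrow> nat list \<Rightarrow> nat \<Rightarrow> bool" where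
  "is_path G u xs v \<longleftrightarrow> xs \<noteq> [] \<and> hd xs = u \<and> last xs = v \<and> distinct xs \<and>
     successively (\<lambda>x y. {x, y} \<in> G) xs"

definition path_length :: "nat list \<Rightarrow> nat" where
  "path_length xs = length xs - 1"

definition diameter_at_most :: "nat \<Rightarrow> graph set" where
  "diameter_at_most d =
     {G \<in> all_graphs. \<forall>u v. \<exists>xs. is_path G u xs v \<and> path_length xs \<le> d}"

section \<open>The game\<close>

datatype colour = Red | White | Green

text \<open>A move consists of the edge picked by Seeker and the new colour given to it by Hider; a play
  is the infinite sequence of moves of the turns \<open>0, 1, 2, \<dots>\<close>.\<close>

type_synonym move = "edge \<times> colour"
type_synonym play = "nat \<Rightarrow> move"

primrec colouring :: "play \<Rightarrow> nat \<Rightarrow> edge \<Rightarrow> colour" where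
  "colouring p 0 = (\<lambda>e. White)"
| "colouring p (Suc n) = (colouring p n)(fst (p n) := snd (p n))"

definition seeker_legal :: "play \<Rightarrow> bool" where
  "seeker_legal p \<longleftrightarrow> (\<forall>n. fst (p n) \<in> all_edges \<and> colouring p n (fst (p n)) = White)"

definition hider_legal :: "play \<Rightarrow> bool" where
  "hider_legal p \<longleftrightarrow> (\<forall>n. snd (p n) \<in> {Green, Red})"

text \<open>In a legal play an edge changes its colour at most once, so every edge has a colour at the
  end: it is green (red) if it is so at some stage, and white if it is so at every stage. The red
  edges play no role in the winning condition.\<close>

definition green_end :: "play \<Rightarrow> edge set" where
  "green_end p = {e \<in> all_edges. \<exists>n. colouring p n e = Green}"

definition white_end :: "play \<Rightarrow> edge set" where
  "white_end p = {e \<in> all_edges. \<forall>n. colouring p n e = White}"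

definition possible_graphs :: "play \<Rightarrow> graph set" where
  "possible_graphs p = {G. green_end p \<subseteq> G \<and> G \<subseteq> green_end p \<union> white_end p}"

definition seeker_wins :: "graph set \<Rightarrow> play \<Rightarrow> bool" where
  "seeker_wins S p \<longleftrightarrow> white_end p \<noteq> {} \<and>
     (possible_graphs p \<subseteq> S \<or> possible_graphs p \<subseteq> all_graphs - S)"

type_synonym strategy = "move list \<Rightarrow> edge"

definition follows :: "strategy \<Rightarrow> play \<Rightarrow> bool" where
  "follows \<sigma> p \<longleftrightarrow> (\<forall>n. fst (p n) = \<sigma> (map p [0..<n]))"

text \<open>Strategies are total functions on histories, so a winning strategy is also required to pick
  a white edge in every position that can arise from it; each such position occurs in an infinite
  play following the strategy.\<close>

definition winning_strategy :: "graph set \<Rightarrow> strategy \<Rightarrow> bool" where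
  "winning_strategy S \<sigma> \<longleftrightarrow>
     (\<forall>p. follows \<sigma> p \<and> hider_legal p \<longrightarrow> seeker_legal p \<and> seeker_wins S p)"

definition infinity_elusive :: "graph set \<Rightarrow> bool" where
  "infinity_elusive S \<longleftrightarrow> \<not> (\<exists>\<sigma>. winning_strategy S \<sigma>)"

end

theory Submission imports Defs "HOL-Library.Sublist" "HOL-Library.Nat_Bijection" begin

text \<open>
  The property is monotone, so a play in which a white edge remains is lost by Seeker as soon as the
  green graph has diameter greater than \<open>d\<close> while the green and white edges together form a graph of
  diameter at most \<open>d\<close>. Only Seeker's lack of a winning strategy is claimed, so Hider may be assumed to
  know the strategy \<open>\<sigma>\<close> of Seeker, and this leads to a dichotomy.

  Suppose first that from every position of \<open>\<sigma>\<close>, and for every edge, Hider can steer the game so that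
  this edge is picked. As there are countably many edges, Hider can take care of them one after the
  other; in the limit no white edge remains, and Hider wins (\<open>not_winning_if_all_edges_reachable\<close>).

  Otherwise there are a position \<open>h\<close> and an edge \<open>e\<close> that \<open>\<sigma>\<close> never picks after \<open>h\<close>, whatever Hider
  does. Only finitely many edges are coloured at \<open>h\<close>, and this leaves enough room for a graph \<open>H\<close> of
  diameter at most \<open>d\<close> that agrees with the colours at \<open>h\<close> and whose diameter exceeds \<open>d\<close> once \<open>e\<close> is
  removed (\<open>pivotal_edge_completion\<close>). From \<open>h\<close> on Hider answers according to \<open>H\<close>. In the end the
  green edges lie in \<open>H - {e}\<close>, and \<open>H\<close> lies in the union of the green and the white edges
  (\<open>not_winning_if_edge_unreachable\<close>).
\<close>

section \<open>Short paths\<close>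

definition joined :: "graph \<Rightarrow> nat \<Rightarrow> nat \<Rightarrow> nat \<Rightarrow> bool" where
  "joined G k u v \<longleftrightarrow> (\<exists>xs. is_path G u xs v \<and> path_length xs \<le> k)"

lemma diameter_at_most_iff_joined:
  "G \<in> diameter_at_most d \<longleftrightarrow> G \<in> all_graphs \<and> (\<forall>u v. joined G d u v)"
  by (simp add: diameter_at_most_def joined_def)

lemma joined_refl: "joined G k u u"
  unfolding joined_def is_path_def path_length_def by (rule exI[of _ "[u]"]) simp

lemma joined_weaken: "joined G k u v \<Longrightarrow> k \<le> l \<Longrightarrow> joined G l u v"
  unfolding joined_def by (meson le_trans)

lemma joined_mono: "joined G k u v \<Longrightarrow> G \<subseteq> G' \<Longrightarrow> joined G' k u v"
  unfolding joined_def is_path_def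
  using successively_mono[of "\<lambda>x y. {x, y} \<in> G" _ "\<lambda>x y. {x, y} \<in> G'"] by blast

lemma joined_sym: "joined G k u v \<Longrightarrow> joined G k v u"
proof -
  assume "joined G k u v"
  then obtain xs where "is_path G u xs v" "path_length xs \<le> k"
    unfolding joined_def by blast
  then have "is_path G v (rev xs) u" "path_length (rev xs) \<le> k"
    unfolding is_path_def path_length_def
    by (auto simp: hd_rev last_rev insert_commute)
  then show ?thesis
    unfolding joined_def by blast
qed

text \<open>Paths must not repeat vertices: if the new first vertex \<open>u\<close> already lies on the path from \<open>v\<close>,
  the part before \<open>u\<close> is dropped.\<close>

lemma joined_step:
  assumes "{u, v} \<in> G" and "joined G k v w"
  shows "joined G (Suc k) u w"
proof -
  obtain xs where xs: "is_path G v xs w" "path_length xs \<le> k"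
    using assms(2) unfolding joined_def by blast
  show ?thesis
  proof (cases "u \<in> set xs")
    case True
    then obtain ys zs where "xs = ys @ u # zs"
      by (meson split_list)
    then have "is_path G u (u # zs) w" "path_length (u # zs) \<le> Suc k"
      using xs by (auto simp: is_path_def path_length_def successively_append_iff)
    then show ?thesis
      unfolding joined_def by blast
  next
    case False
    then have "is_path G u (u # xs) w" "path_length (u # xs) \<le> Suc k"
      using xs assms(1)
      by (auto simp: is_path_def path_length_def successively_Cons)
    then show ?thesis
      unfolding joined_def by blast
  qed
qed

lemma joined_edge: "{u, v} \<in> G \<Longrightarrow> joined G (Suc k) u v"
  by (rule joined_step[OF _ joined_refl])

text \<open>Lower bounds on distances come from functions that change by at most one along each edge.\<close>

lemma level_le_if_joined:
  fixes f :: "nat \<Rightarrow> nat"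
  assumes lip: "\<And>x y. {x, y} \<in> G \<Longrightarrow> f x \<le> Suc (f y)" and "joined G k u v"
  shows "f u \<le> f v + k"
proof -
  have "f (hd xs) \<le> f (last xs) + path_length xs"
    if "xs \<noteq> []" "successively (\<lambda>x y. {x, y} \<in> G) xs" for xs
    using that
  proof (induction xs rule: induct_list012)
    case (3 x y zs)
    then have "f x \<le> Suc (f y)" "f y \<le> f (last (y # zs)) + path_length (y # zs)"
      using lip by auto
    then show ?case
      by (simp add: path_length_def)
  qed (auto simp: path_length_def)
  then show ?thesis
    using assms(2) unfolding joined_def is_path_def by fastforce
qed

lemma diameter_at_most_mono:
  "G \<in> diameter_at_most d \<Longrightarrow> G \<subseteq> G' \<Longrightarrow> G' \<in> all_graphs \<Longrightarrow> G' \<in> diameter_at_most d"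
  using joined_mono unfolding diameter_at_most_iff_joined by blast

lemma diameter_at_most_image:
  assumes "bij \<pi>" and G: "G \<in> diameter_at_most d"
  shows "(\<lambda>e. \<pi> ` e) ` G \<in> diameter_at_most d"
proof -
  have inj: "inj \<pi>" and surj: "surj \<pi>"
    using assms(1) by (auto simp: bij_def)
  have "\<pi> ` e \<in> all_edges" if e: "e \<in> all_edges" for e
  proof -
    obtain n k where "e = {n, k}" "n \<noteq> k"
      using e unfolding all_edges_def by blast
    then have "\<pi> ` e = {\<pi> n, \<pi> k}" "\<pi> n \<noteq> \<pi> k"
      using inj by (auto simp: inj_eq)
    then show ?thesis
      unfolding all_edges_def by blast
  qed
  then have "(\<lambda>e. \<pi> ` e) ` G \<in> all_graphs"
    using G unfolding diameter_at_most_def all_graphs_def by auto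
  moreover have "joined ((\<lambda>e. \<pi> ` e) ` G) d u v" for u v
  proof -
    obtain u' v' where uv: "u = \<pi> u'" "v = \<pi> v'"
      using surj by (metis surjD)
    obtain xs where xs: "is_path G u' xs v'" "path_length xs \<le> d"
      using G unfolding diameter_at_most_def by blast
    have "successively (\<lambda>x y. {\<pi> x, \<pi> y} \<in> (\<lambda>e. \<pi> ` e) ` G) xs"
    proof (rule successively_mono)
      show "successively (\<lambda>x y. {x, y} \<in> G) xs"
        using xs by (simp add: is_path_def)
      show "{\<pi> x, \<pi> y} \<in> (\<lambda>e. \<pi> ` e) ` G" if "{x, y} \<in> G" for x y
        using imageI[OF that, of "\<lambda>e. \<pi> ` e"] by simp
    qed
    then have "is_path ((\<lambda>e. \<pi> ` e) ` G) u (map \<pi> xs) v"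
      using xs(1) inj uv
      by (auto simp: is_path_def hd_map last_map distinct_map successively_map
          intro: inj_on_subset)
    then show ?thesis
      using xs(2) unfolding joined_def path_length_def by (metis length_map)
  qed
  ultimately show ?thesis
    by (simp add: diameter_at_most_iff_joined)
qed

lemma graph_property_diameter_at_most: "graph_property (diameter_at_most d)"
proof -
  have "G \<in> diameter_at_most d"
    if "bij \<pi>" "(\<lambda>e. \<pi> ` e) ` G \<in> diameter_at_most d" for \<pi> G
  proof -
    have "(\<lambda>e. inv \<pi> ` e) ` (\<lambda>e. \<pi> ` e) ` G = G"
      using that(1) by (simp add: image_image bij_is_inj)
    then show ?thesis
      using diameter_at_most_image[OF bij_imp_bij_inv[OF that(1)] that(2)] by simp
  qed
  moreover have "diameter_at_most d \<subseteq> all_graphs"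
    by (auto simp: diameter_at_most_def)
  ultimately show ?thesis
    using diameter_at_most_image unfolding graph_property_def by blast
qed

section \<open>Making a given edge pivotal\<close>

text \<open>
  The diameter exceeds \<open>d\<close> without \<open>e = {u, v}\<close> because of a function \<open>f\<close> with range \<open>{0..d + 1}\<close> that
  changes by at most one along each edge of \<open>H\<close> except \<open>e\<close>, where it jumps from \<open>f u = 0\<close> to \<open>f v = 2\<close>.
  All other vertices of the finite part \<open>{..<M}\<close>, which carries the prescribed edges, get the value
  \<open>1\<close>, so that these edges respect \<open>f\<close> no matter what they are. All edges that respect \<open>f\<close> and have
  an end outside this part belong to \<open>H\<close>. The fresh vertex \<open>M\<close> at level \<open>1\<close> is therefore adjacent to
  all other vertices of level at most \<open>2\<close>; infinitely many fresh vertices lie at level \<open>2\<close>; and the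
  levels from \<open>3\<close> to \<open>d + 1\<close> consist of one vertex each, forming a path. Each level up to \<open>2\<close> is at
  distance at most \<open>2\<close> from the vertex of level \<open>3\<close>, level \<open>0\<close> only thanks to \<open>e\<close>.
\<close>

lemma pivotal_edge_completion:
  assumes "finite A" "finite B" "A \<subseteq> all_edges" "B \<subseteq> all_edges" "A \<inter> B = {}"
    and "e \<in> all_edges" "e \<notin> A" "e \<notin> B" "2 \<le> d"
  obtains H where "A \<subseteq> H" "e \<in> H" "H \<inter> B = {}" "H \<in> diameter_at_most d"
    and "H - {e} \<notin> diameter_at_most d"
proof -
  obtain u v where e: "e = {u, v}" "u \<noteq> v"
    using assms(6) unfolding all_edges_def by blast
  have "finite (\<Union>(insert e (A \<union> B)))"
  proof (rule finite_Union)
    show "finite (insert e (A \<union> B))"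
      using assms(1,2) by simp
    show "finite g" if "g \<in> insert e (A \<union> B)" for g
    proof -
      have "g \<in> all_edges"
        using that assms(3,4,6) by auto
      then show ?thesis
        unfolding all_edges_def by auto
    qed
  qed
  then obtain M where M: "\<forall>x \<in> \<Union>(insert e (A \<union> B)). x < M"
    using finite_nat_set_iff_bounded by blast
  have uvM: "u < M" "v < M"
    using M e by auto
  define f where "f x = (if x = u then 0 else if x = v then 2 else if x \<le> M then 1
    else if x < M + d then x - M + 2 else 2)" for x
  define N where "N = {{x, y} | x y. M \<le> x \<and> x \<noteq> y \<and> f x \<le> Suc (f y) \<and> f y \<le> Suc (f x)}"
  define H where "H = insert e (A \<union> N)"
  have N_I: "{x, y} \<in> H" if "M \<le> x" "x \<noteq> y" "f x \<le> Suc (f y)" "f y \<le> Suc (f x)" for x y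
    using that unfolding H_def N_def by blast
  have N_avoids: "\<exists>x\<in>g. M \<le> x" if "g \<in> N" for g
    using that unfolding N_def by auto
  have "N \<subseteq> all_edges"
    unfolding N_def all_edges_def by blast
  then have H_graph: "H \<in> all_graphs"
    using assms(3,6) unfolding H_def all_graphs_def by simp
  have H_B: "H \<inter> B = {}"
  proof (rule ccontr)
    assume "H \<inter> B \<noteq> {}"
    then obtain g where g: "g \<in> N" "g \<in> B"
      using assms(5,8) unfolding H_def by blast
    then obtain x where "x \<in> g" "M \<le> x"
      using N_avoids by blast
    then show False
      using M g(2) by (meson UN_I UnI2 Union_iff insertI2 not_le)
  qed

  have f_simps: "f u = 0" "f v = 2" "f M = 1" "f (M + d) = 2" "f (Suc M) = 3"
    using uvM e assms(9) by (auto simp: f_def)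
  have f_0: "x = u" if "f x = 0" for x
    using that by (auto simp: f_def split: if_splits)
  have f_high: "x = M + (f x - 2) \<and> M < x \<and> x < M + d" if "3 \<le> f x" for x
    using that by (auto simp: f_def split: if_splits)

  have low: "joined H 2 x y" if "f x \<le> 2" "f y \<le> 2" for x y
  proof -
    have hub: "{M, z} \<in> H" if "f z \<le> 2" "z \<noteq> M" for z
      using that f_simps by (intro N_I) auto
    show ?thesis
    proof (cases "x = M \<or> y = M")
      case True
      then show ?thesis
        using hub[OF that(1)] hub[OF that(2)] joined_edge[of x y H 1] joined_refl[of H 2 x]
        by (metis Suc_1 insert_commute)
    next
      case False
      then have "{x, M} \<in> H" "{M, y} \<in> H"
        using hub[OF that(1)] hub[OF that(2)] by (simp_all add: insert_commute)
      then show ?thesis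
        using joined_step[OF _ joined_edge] by (metis numeral_2_eq_2)
    qed
  qed

  have high: "joined H (k + 2) x y" if "f x = k + 3" "f y \<le> f x" for k x y
    using that
  proof (induction k arbitrary: x)
    case 0
    then have x: "x = Suc M"
      using f_high[of x] by simp
    consider "y = x" | "f y = 3" "y \<noteq> x" | "f y = 2" | "f y = 1" | "f y = 0"
      using 0 by linarith
    then show ?case
    proof cases
      case 1
      then show ?thesis by (simp add: joined_refl)
    next
      case 2
      then show ?thesis
        using f_high[of y] x by simp
    next
      case 3
      then have "{x, y} \<in> H"
        using f_simps x by (intro N_I) auto
      then show ?thesis
        using joined_edge[of x y H 1] by (simp add: numeral_2_eq_2)
    next
      case 4
      \<comment> \<open>The vertex \<open>M + d\<close> is a fresh vertex of level \<open>2\<close>.\<close>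
      have "{x, M + d} \<in> H" "{M + d, y} \<in> H"
        using f_simps x 4 assms(9) by (auto intro!: N_I)
      then show ?thesis
        using joined_step[OF _ joined_edge] by (simp add: numeral_2_eq_2)
    next
      case 5
      have "{x, v} \<in> H"
        using f_simps x uvM by (intro N_I) auto
      moreover have "{v, y} \<in> H"
        using f_0[OF 5] e unfolding H_def by (simp add: insert_commute)
      ultimately show ?thesis
        using joined_step[OF _ joined_edge] by (simp add: numeral_2_eq_2)
    qed
  next
    case (Suc k)
    have x: "x = M + (k + 2)" "k + 2 < d"
      using f_high[of x] Suc.prems(1) by auto
    then have pred: "f (x - 1) = k + 3"
      using uvM by (auto simp: f_def)
    show ?case
    proof (cases "f y = f x")
      case True
      then have "y = x"
        using f_high[of x] f_high[of y] Suc.prems(1) by simp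
      then show ?thesis by (simp add: joined_refl)
    next
      case False
      then have "joined H (k + 2) (x - 1) y"
        using Suc.prems pred by (intro Suc.IH) auto
      moreover have "{x, x - 1} \<in> H"
        using x pred Suc.prems by (intro N_I) auto
      ultimately show ?thesis
        using joined_step by fastforce
    qed
  qed

  have ordered: "joined H d x y" if "f y \<le> f x" for x y
  proof (cases "f x \<le> 2")
    case True
    then show ?thesis
      using low[of x y] that assms(9) joined_weaken by fastforce
  next
    case False
    then have "f x = (f x - 3) + 3" "f x - 3 + 2 \<le> d"
      using f_high[of x] by auto
    then show ?thesis
      using high[OF _ that] joined_weaken by blast
  qed
  have "H \<in> diameter_at_most d"
    unfolding diameter_at_most_iff_joined
    using H_graph ordered joined_sym by (metis nat_le_linear)

  moreover have "H - {e} \<notin> diameter_at_most d"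
  proof
    assume *: "H - {e} \<in> diameter_at_most d"
    have "f x \<le> Suc (f y)" if xy: "{x, y} \<in> H - {e}" for x y
    proof (cases "{x, y} \<in> N")
      case True
      then show ?thesis
        unfolding N_def by (auto simp: doubleton_eq_iff)
    next
      case False
      then have "{x, y} \<in> A"
        using xy unfolding H_def by auto
      then have "x < M" "y < M" "{x, y} \<noteq> {u, v}"
        using M xy e by auto
      then show ?thesis
        by (auto simp: f_def insert_commute)
    qed
    \<comment> \<open>The vertex \<open>M + (d - 1)\<close> is the one of the highest level, \<open>d + 1\<close>.\<close>
    then have "f (M + (d - 1)) \<le> f u + d"
      using * level_le_if_joined[of "H - {e}" f] unfolding diameter_at_most_iff_joined by blast
    moreover have "f (M + (d - 1)) = d + 1"
      using uvM assms(9) by (auto simp: f_def)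
    ultimately show False
      using f_simps by simp
  qed
  ultimately show ?thesis
    using that[of H] H_B unfolding H_def by blast
qed

section \<open>Histories and plays\<close>

definition legal_history :: "strategy \<Rightarrow> move list \<Rightarrow> bool" where
  "legal_history \<sigma> h \<longleftrightarrow>
     (\<forall>i < length h. fst (h ! i) = \<sigma> (take i h) \<and> snd (h ! i) \<in> {Green, Red})"

lemma legal_history_Nil: "legal_history \<sigma> []"
  by (simp add: legal_history_def)

lemma legal_history_snoc:
  "legal_history \<sigma> h \<Longrightarrow> c \<in> {Green, Red} \<Longrightarrow> legal_history \<sigma> (h @ [(\<sigma> h, c)])"
  by (auto simp: legal_history_def nth_append less_Suc_eq)

lemma play_through_histories:
  assumes legal: "\<And>n. legal_history \<sigma> (h n)"
    and step: "\<And>n. prefix (h n) (h (Suc n))" and len: "\<And>n. n \<le> length (h n)"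
  obtains p where "follows \<sigma> p" "hider_legal p" "\<And>n. map p [0..<length (h n)] = h n"
proof -
  have chain: "prefix (h m) (h n)" if "m \<le> n" for m n
    using that by (induction rule: dec_induct) (auto intro: prefix_order.trans step)
  define p where "p k = h (Suc k) ! k" for k
  have p_nth: "p k = h n ! k" if "k < length (h n)" for k n
  proof -
    have "k < length (h (Suc k))"
      using len[of "Suc k"] by simp
    then show ?thesis
      using chain[of n "Suc k"] chain[of "Suc k" n] that unfolding p_def
      by (metis nat_le_linear nth_append prefix_def)
  qed
  have p_take: "map p [0..<k] = take k (h n)" if "k \<le> length (h n)" for k n
    using that by (intro nth_equalityI) (auto simp: p_nth)
  have p_move: "fst (p k) = \<sigma> (map p [0..<k]) \<and> snd (p k) \<in> {Green, Red}" for k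
    using legal[of "Suc k"] len[of "Suc k"] p_nth[of k "Suc k"] p_take[of k "Suc k"]
    unfolding legal_history_def by simp
  show ?thesis
  proof
    show "follows \<sigma> p" "hider_legal p"
      using p_move unfolding follows_def hider_legal_def by auto
    show "map p [0..<length (h n)] = h n" for n
      using p_take[of "length (h n)" n] by simp
  qed
qed

lemma legal_history_take_play:
  assumes "follows \<sigma> p" "hider_legal p"
  shows "legal_history \<sigma> (map p [0..<n])"
  using assms by (auto simp: legal_history_def follows_def hider_legal_def take_map)

text \<open>Once Hider aims at a fixed graph, the reply depends on the edge picked and no longer on the
  history.\<close>

lemma play_with_replies:
  assumes "legal_history \<sigma> h" and reply: "\<And>e. r e \<in> {Green, Red}"
  obtains p where "follows \<sigma> p" "hider_legal p" "map p [0..<length h] = h"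
    and "\<And>k. length h \<le> k \<Longrightarrow> snd (p k) = r (fst (p k))"
proof -
  define H where "H n = ((\<lambda>g. g @ [(\<sigma> g, r (\<sigma> g))]) ^^ n) h" for n
  have H_0: "H 0 = h" and H_Suc: "H (Suc n) = H n @ [(\<sigma> (H n), r (\<sigma> (H n)))]" for n
    by (simp_all add: H_def)
  have len: "length (H n) = length h + n" for n
    by (induction n) (auto simp: H_0 H_Suc)
  have legal: "legal_history \<sigma> (H n)" for n
    by (induction n) (auto simp only: H_0 H_Suc assms legal_history_snoc)
  obtain p where p: "follows \<sigma> p" "hider_legal p" "\<And>n. map p [0..<length (H n)] = H n"
  proof (rule play_through_histories)
    show "legal_history \<sigma> (H n)" "prefix (H n) (H (Suc n))" "n \<le> length (H n)" for n
      using legal by (simp_all add: H_Suc len)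
  qed blast
  have "snd (p k) = r (fst (p k))" if k_ge: "length h \<le> k" for k
  proof -
    obtain n where k: "k = length h + n"
      using k_ge le_Suc_ex by blast
    have "p k = H (Suc n) ! k"
      using arg_cong[OF p(3)[of "Suc n"], of "\<lambda>g. g ! k"] k by (simp add: len del: upt_Suc)
    then show ?thesis
      by (simp add: H_Suc nth_append len k)
  qed
  moreover have "map p [0..<length h] = h"
    using p(3)[of 0] by (simp add: H_0)
  ultimately show ?thesis
    using that p by blast
qed

lemma colouring_White_iff:
  assumes "hider_legal p"
  shows "colouring p n e = White \<longleftrightarrow> (\<forall>k<n. fst (p k) \<noteq> e)"
proof (induction n)
  case (Suc n)
  have "snd (p n) \<in> {Green, Red}"
    using assms unfolding hider_legal_def by blast
  then have "snd (p n) \<noteq> White"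
    by auto
  then show ?case
    using Suc by (auto simp: less_Suc_eq)
qed simp

lemma colouring_Green_imp_move:
  "colouring p n e = Green \<Longrightarrow> \<exists>k<n. p k = (e, Green)"
  by (induction n) (auto simp: less_Suc_eq prod_eq_iff split: if_splits)

lemma colouring_Suc_move: "p k = (e, c) \<Longrightarrow> colouring p (Suc k) e = c"
  by simp

lemma picked_once:
  assumes "seeker_legal p" "hider_legal p" "fst (p i) = fst (p j)"
  shows "i = j"
  using assms colouring_White_iff[OF assms(2)] unfolding seeker_legal_def
  by (metis linorder_neqE_nat)

section \<open>Hider beats every strategy\<close>

text \<open>Whatever the property is, Hider wins a play that leaves no edge white. Such a play arises as the
  limit of a chain of histories, the \<open>n\<close>-th of which contains the first \<open>n\<close> edges.\<close>

lemma not_winning_if_all_edges_reachable: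
  assumes reach: "\<And>h e. legal_history \<sigma> h \<Longrightarrow> e \<in> all_edges \<Longrightarrow>
      \<exists>h'. legal_history \<sigma> h' \<and> prefix h h' \<and> e \<in> fst ` set h'"
  shows "\<not> winning_strategy S \<sigma>"
proof
  assume win: "winning_strategy S \<sigma>"
  define E where "E n = (case prod_decode n of (i, j) \<Rightarrow> {i, j})" for n :: nat
  have next_history: "\<exists>h'. legal_history \<sigma> h' \<and> (prefix h h' \<and> length h < length h' \<and>
      (E n \<in> all_edges \<longrightarrow> E n \<in> fst ` set h'))"
    if h: "legal_history \<sigma> h" for h n
  proof -
    \<comment> \<open>One arbitrary extra turn makes the histories grow even if the edge has been picked
      before.\<close>
    have "legal_history \<sigma> (h @ [(\<sigma> h, Red)])"
      using h by (simp add: legal_history_snoc)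
    then obtain h' where "legal_history \<sigma> h'" "prefix (h @ [(\<sigma> h, Red)]) h'"
      "E n \<in> all_edges \<longrightarrow> E n \<in> fst ` set h'"
      using reach by (metis prefix_order.refl)
    moreover from this have "prefix h h'" "length h < length h'"
      by (auto simp: prefix_def)
    ultimately show ?thesis
      by blast
  qed
  obtain h where h: "\<And>n. legal_history \<sigma> (h n)" "\<And>n. prefix (h n) (h (Suc n))"
      "\<And>n. length (h n) < length (h (Suc n))"
      "\<And>n. E n \<in> all_edges \<Longrightarrow> E n \<in> fst ` set (h (Suc n))"
  proof -
    have "\<exists>h. \<forall>n. legal_history \<sigma> (h n) \<and> (prefix (h n) (h (Suc n)) \<and>
        length (h n) < length (h (Suc n)) \<and>
        (E n \<in> all_edges \<longrightarrow> E n \<in> fst ` set (h (Suc n))))"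
      by (rule dependent_nat_choice[where P = "\<lambda>_. legal_history \<sigma>"])
        (use legal_history_Nil in blast, rule next_history)
    then show thesis
      using that by blast
  qed
  have "n \<le> length (h n)" for n
  proof (induction n)
    case (Suc n)
    then show ?case
      using h(3)[of n] by simp
  qed simp
  then obtain p where p: "follows \<sigma> p" "hider_legal p" "\<And>n. map p [0..<length (h n)] = h n"
    using play_through_histories[of \<sigma> h] h(1,2) by blast
  have "\<exists>k. fst (p k) = e" if e: "e \<in> all_edges" for e
  proof -
    obtain i j where "e = {i, j}"
      using e unfolding all_edges_def by blast
    then have "E (prod_encode (i, j)) = e"
      by (simp add: E_def)
    then have "e \<in> fst ` set (h (Suc (prod_encode (i, j))))"
      using h(4) e by metis
    then have "e \<in> fst ` set (map p [0..<length (h (Suc (prod_encode (i, j))))])"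
      by (simp only: p(3))
    then show ?thesis
      by auto
  qed
  then have "white_end p = {}"
    using colouring_White_iff[OF p(2)] unfolding white_end_def by blast
  then show False
    using win p unfolding winning_strategy_def seeker_wins_def by blast
qed

text \<open>Hider need not foresee which edges other than \<open>e\<close> stay white. Such an edge of \<open>H\<close> is missing
  from the green graph, which can only increase the diameter of the latter, and such an edge outside
  \<open>H\<close> can only decrease the diameter of the union of the green and the white edges.\<close>

lemma not_winning_if_edge_unreachable:
  assumes "2 \<le> d" and h: "legal_history \<sigma> h" and e: "e \<in> all_edges"
    and unreachable: "\<And>h'. legal_history \<sigma> h' \<Longrightarrow> prefix h h' \<Longrightarrow> e \<notin> fst ` set h'"
  shows "\<not> winning_strategy (diameter_at_most d) \<sigma>"
proof
  assume win: "winning_strategy (diameter_at_most d) \<sigma>"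
  define A where "A = {g. (g, Green) \<in> set h}"
  define B where "B = {g. (g, Red) \<in> set h}"
  have "A \<subseteq> fst ` set h" "B \<subseteq> fst ` set h"
    unfolding A_def B_def by force+
  then have fin: "finite A" "finite B"
    by (auto intro: finite_subset)
  \<comment> \<open>As \<open>\<sigma>\<close> is winning, Seeker picks only white edges in any continuation \<open>q\<close>, hence in \<open>h\<close>.\<close>
  obtain q where q: "follows \<sigma> q" "hider_legal q" "map q [0..<length h] = h"
    using play_with_replies[OF h, of "\<lambda>_. Red"] by auto
  then have q_legal: "seeker_legal q"
    using win unfolding winning_strategy_def by blast
  have in_h: "\<exists>k. q k = m" if "m \<in> set h" for m
    using that q(3) by (metis imageE set_map)
  have "fst m \<in> all_edges" if "m \<in> set h" for m
    using in_h[OF that] q_legal unfolding seeker_legal_def by blast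
  then have edges: "A \<subseteq> all_edges" "B \<subseteq> all_edges"
    unfolding A_def B_def by fastforce+
  have disj: "A \<inter> B = {}"
  proof (rule ccontr)
    assume "A \<inter> B \<noteq> {}"
    then obtain g i j where "q i = (g, Green)" "q j = (g, Red)"
      using in_h unfolding A_def B_def by blast
    then show False
      using picked_once[OF q_legal q(2), of i j] by auto
  qed
  have "e \<notin> A" "e \<notin> B"
    using unreachable[OF h] unfolding A_def B_def by (auto simp: rev_image_eqI)
  then obtain H where H: "A \<subseteq> H" "e \<in> H" "H \<inter> B = {}" "H \<in> diameter_at_most d"
    "H - {e} \<notin> diameter_at_most d"
    using pivotal_edge_completion fin edges disj e assms(1) by metis
  obtain p where p: "follows \<sigma> p" "hider_legal p" "map p [0..<length h] = h"
    "\<And>k. length h \<le> k \<Longrightarrow> snd (p k) = (if fst (p k) \<in> H then Green else Red)"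
    by (rule play_with_replies[OF h, of "\<lambda>g. if g \<in> H then Green else Red"]) auto
  have early: "p k \<in> set h" if "k < length h" for k
    using that arg_cong[OF p(3), of set] by auto
  have not_e: "fst (p k) \<noteq> e" for k
  proof -
    define n where "n = max (Suc k) (length h)"
    have "[0..<n] = [0..<length h] @ [length h..<n]"
      using upt_add_eq_append[of 0 "length h" "n - length h"] by (simp add: n_def)
    then have "prefix h (map p [0..<n])"
      using p(3) by simp
    then have "e \<notin> fst ` set (map p [0..<n])"
      using unreachable legal_history_take_play[OF p(1,2)] by blast
    moreover have "p k \<in> set (map p [0..<n])"
      by (simp add: n_def)
    ultimately show ?thesis
      by blast
  qed
  have Green_in_H: "g \<in> H" if "p k = (g, Green)" for g k
  proof (cases "k < length h")
    case True
    then show ?thesis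
      using early[OF True] that H(1) unfolding A_def by auto
  next
    case False
    then show ?thesis
      using p(4)[of k] that by (simp split: if_splits)
  qed
  have H_Green: "snd (p k) = Green" if "fst (p k) \<in> H" for k
  proof (cases "k < length h")
    case True
    have "fst (p k) \<notin> B"
      using that H(3) by blast
    then have "snd (p k) \<noteq> Red"
      using early[OF True] unfolding B_def by (metis mem_Collect_eq prod.collapse)
    moreover have "snd (p k) \<in> {Green, Red}"
      using p(2) unfolding hider_legal_def by blast
    ultimately show ?thesis
      by blast
  next
    case False
    then show ?thesis
      using p(4)[of k] that by simp
  qed
  have green: "green_end p \<subseteq> H - {e}"
  proof
    fix g assume "g \<in> green_end p"
    then obtain k where k: "p k = (g, Green)"
      unfolding green_end_def using colouring_Green_imp_move by blast
    then show "g \<in> H - {e}"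
      using Green_in_H[OF k] not_e[of k] by simp
  qed
  have green_white: "H \<subseteq> green_end p \<union> white_end p"
  proof
    fix g assume g: "g \<in> H"
    have "g \<in> all_edges"
      using g H(4) unfolding diameter_at_most_def all_graphs_def by blast
    moreover have "\<exists>n. colouring p n g = Green" if "fst (p k) = g" for k
    proof -
      have "p k = (g, Green)"
        using H_Green[of k] that g by (simp add: prod_eq_iff)
      then show ?thesis
        using colouring_Suc_move by blast
    qed
    ultimately show "g \<in> green_end p \<union> white_end p"
      using colouring_White_iff[OF p(2)] unfolding green_end_def white_end_def by blast
  qed
  have "H - {e} \<in> all_graphs"
    using H(4) unfolding diameter_at_most_def all_graphs_def by blast
  then have "green_end p \<notin> diameter_at_most d"
    using diameter_at_most_mono green H(5) by blast
  moreover have "green_end p \<union> white_end p \<in> diameter_at_most d"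
    by (rule diameter_at_most_mono[OF H(4) green_white])
      (auto simp: all_graphs_def green_end_def white_end_def)
  moreover have "green_end p \<in> possible_graphs p" "green_end p \<union> white_end p \<in> possible_graphs p"
    unfolding possible_graphs_def by auto
  ultimately have "\<not> seeker_wins (diameter_at_most d) p"
    unfolding seeker_wins_def by blast
  then show False
    using win p(1,2) unfolding winning_strategy_def by blast
qed

theorem theorem3p7:
  fixes d :: nat
  assumes "2 \<le> d"
  shows "graph_property (diameter_at_most d) \<and> infinity_elusive (diameter_at_most d)"
proof
  show "infinity_elusive (diameter_at_most d)"
    unfolding infinity_elusive_def
  proof
    assume "\<exists>\<sigma>. winning_strategy (diameter_at_most d) \<sigma>"
    then obtain \<sigma> where win: "winning_strategy (diameter_at_most d) \<sigma>" ..
    have "\<exists>h'. legal_history \<sigma> h' \<and> prefix h h' \<and> e \<in> fst ` set h'"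
      if "legal_history \<sigma> h" "e \<in> all_edges" for h e
      using not_winning_if_edge_unreachable[OF assms that] win by blast
    then show False
      using not_winning_if_all_edges_reachable win by blast
  qed
qed (rule graph_property_diameter_at_most)

end
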